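(* Let $G=(V,E)$ be a connected block graph. Then $rad(G)\leq \frac{3}{2}\cdot dc(G)+1$.
   Context: All graphs are finite, simple and undirected. A block of a graph is a maximal 2-connected subgraph; $G$ is a block graph if every block of $G$ is a complete graph (clique). $rad(G)=\min_{u\in V}\max_{v\in V} d(u,v)$ is the radius of the connected graph $G$, where $d$ is the shortest-path distance. A cluster graph is a disjoint union of complete graphs; the distance to cluster $dc(G)$ is the minimum number of vertices of $G$ whose removal yields a cluster graph. *)

theory Defs
  imports "Graph_Theory.Graph_Theory" "HOL-Library.Disjoint_Sets"
begin

text \<open>
  A finite simple undirected graph is the library's \<^locale>\<open>graph\<close>: a finite symmetric
  digraph without loops and parallel arcs, each edge being a pair of opposite arcs.
  A subgraph in the sense of \<^const>\<open>subgraph\<close> need not be symmetric, so predicates on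
  subgraphs require \<^locale>\<open>graph\<close> explicitly.
\<close>

text \<open>For a \<^locale>\<open>graph\<close>, the library's (weak) connectedness is the usual notion.\<close>

abbreviation connected_graph :: "('a,'b) pre_digraph \<Rightarrow> bool" where
  "connected_graph G \<equiv> Digraph_Component.connected G"

abbreviation is_clique :: "('a,'b) pre_digraph \<Rightarrow> bool" where
  "is_clique G \<equiv> complete_digraph (card (verts G)) G"

definition two_connected :: "('a,'b) pre_digraph \<Rightarrow> bool" where
  "two_connected G \<longleftrightarrow> graph G \<and> 2 < card (verts G) \<and> connected_graph G \<and>
     (\<forall>v\<in>verts G. connected_graph (G \<restriction> (verts G - {v})))"

definition is_block :: "('a,'b) pre_digraph \<Rightarrow> ('a,'b) pre_digraph \<Rightarrow> bool" where
  "is_block G B \<longleftrightarrow> pre_digraph.max_subgraph G two_connected B"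

text \<open>
  Some authors also count bridges and isolated vertices as blocks. These are cliques
  anyway, so the following class of graphs is the same under either convention.
\<close>

definition block_graph :: "('a,'b) pre_digraph \<Rightarrow> bool" where
  "block_graph G \<longleftrightarrow> (\<forall>B. is_block G B \<longrightarrow> is_clique B)"

text \<open>Distances are valued in \<^typ>\<open>ereal\<close>, as \<^const>\<open>wf_digraph.\<mu>\<close> is.\<close>

definition graph_dist :: "('a,'b) pre_digraph \<Rightarrow> 'a \<Rightarrow> 'a \<Rightarrow> ereal" where
  "graph_dist G u v = wf_digraph.\<mu> G (\<lambda>_. 1) u v"

definition rad :: "('a,'b) pre_digraph \<Rightarrow> ereal" where
  "rad G = (MIN u\<in>verts G. MAX v\<in>verts G. graph_dist G u v)"

text \<open>The members of \<open>P\<close> are the vertex sets of the complete graphs.\<close>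

definition cluster_graph :: "('a,'b) pre_digraph \<Rightarrow> bool" where
  "cluster_graph G \<longleftrightarrow> graph G \<and>
     (\<exists>P. partition_on (verts G) P \<and> arcs_ends G = (\<Union>C\<in>P. {(u,v). u \<in> C \<and> v \<in> C \<and> u \<noteq> v}))"

definition dc :: "('a,'b) pre_digraph \<Rightarrow> nat" where
  "dc G = Min {card S |S. S \<subseteq> verts G \<and> cluster_graph (G \<restriction> (verts G - S))}"

end

theory Submission
  imports Defs
begin

text \<open>
  Let \<open>f 0, \<dots>, f n\<close> be a shortest path realising the diameter. In a block graph every inner
  vertex of a shortest path separates its ends, since otherwise its two neighbours on the path
  would lie in a common block and be adjacent. So every vertex \<open>x\<close> is separated by the
  middle vertex from \<open>f 0\<close> or from \<open>f n\<close>, which gives \<open>2 * rad G \<le> n + 1\<close>. On the other hand, the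
  path contains \<open>(n + 1) div 3\<close> disjoint induced paths on three vertices, all of which a
  cluster deletion set must hit, so \<open>n \<le> 3 * dc G + 1\<close>.
\<close>

section \<open>Distances and shortest paths in a relation\<close>

definition rel_dist :: "'a rel \<Rightarrow> 'a \<Rightarrow> 'a \<Rightarrow> nat" where
  "rel_dist R u v = (LEAST n. (u, v) \<in> R ^^ n)"

lemma rel_dist_le: "(u, v) \<in> R ^^ n \<Longrightarrow> rel_dist R u v \<le> n"
  unfolding rel_dist_def by (rule Least_le)

text \<open>Reachability matters here: for an unreachable pair, \<open>LEAST\<close> ranges over no
  number at all and \<open>rel_dist\<close> has an unspecified value.\<close>

lemma relpow_rel_dist:
  assumes "(u, v) \<in> R\<^sup>*"
  shows "(u, v) \<in> R ^^ rel_dist R u v"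
proof -
  obtain n where "(u, v) \<in> R ^^ n"
    using assms rtrancl_imp_relpow by metis
  then show ?thesis
    unfolding rel_dist_def by (rule LeastI)
qed

lemma sym_relpow:
  assumes "sym R" "(u, v) \<in> R ^^ n"
  shows "(v, u) \<in> R ^^ n"
  using assms(2)
proof (induction n arbitrary: v)
  case (Suc n)
  then obtain w where "(u, w) \<in> R ^^ n" "(w, v) \<in> R"
    by auto
  with Suc.IH assms(1) show ?case
    by (metis relpow_Suc_I2 symD)
qed simp

lemma rel_dist_commute: "sym R \<Longrightarrow> rel_dist R u v = rel_dist R v u"
  unfolding rel_dist_def by (metis sym_relpow)

text \<open>Minimality is demanded for the two ends only; for the segments it follows by replacing a
  segment with a shorter walk. Values of \<open>f\<close> beyond \<open>n\<close> are
  unconstrained.\<close>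

definition geodesic :: "'a rel \<Rightarrow> (nat \<Rightarrow> 'a) \<Rightarrow> nat \<Rightarrow> bool" where
  "geodesic R f n \<longleftrightarrow> (\<forall>i<n. (f i, f (Suc i)) \<in> R) \<and> (\<forall>m. (f 0, f n) \<in> R ^^ m \<longrightarrow> n \<le> m)"

lemma geodesic_exists:
  assumes "(u, v) \<in> R\<^sup>*"
  obtains f where "geodesic R f (rel_dist R u v)" "f 0 = u" "f (rel_dist R u v) = v"
proof -
  obtain f where "f 0 = u" "f (rel_dist R u v) = v"
    "\<forall>i<rel_dist R u v. (f i, f (Suc i)) \<in> R"
    using relpow_rel_dist[OF assms] unfolding relpow_fun_conv by blast
  then show ?thesis
    using that[of f] unfolding geodesic_def by (auto intro: rel_dist_le)
qed

lemma path_segment_relpow: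
  assumes "\<forall>i<n. (f i, f (Suc i)) \<in> R" "i \<le> j" "j \<le> n"
  shows "(f i, f j) \<in> R ^^ (j - i)"
  unfolding relpow_fun_conv
  by (rule exI[where x = "\<lambda>k. f (i + k)"]) (use assms in auto)

lemma geodesic_step: "geodesic R f n \<Longrightarrow> i < n \<Longrightarrow> (f i, f (Suc i)) \<in> R"
  by (simp add: geodesic_def)

text \<open>Replacing the segment between \<open>f i\<close> and \<open>f j\<close> by a walk of
  length \<open>m\<close> gives a walk between the ends of length \<open>i + m + (n - j)\<close>,
  which cannot be below \<open>n\<close>.\<close>

lemma geodesic_length_le:
  assumes "geodesic R f n" "i \<le> j" "j \<le> n" "(f i, f j) \<in> R ^^ m"
  shows "j \<le> i + m"
proof -
  have steps: "\<forall>i<n. (f i, f (Suc i)) \<in> R"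
    using assms(1) by (simp add: geodesic_def)
  have "(f 0, f i) \<in> R ^^ i" "(f j, f n) \<in> R ^^ (n - j)"
    using path_segment_relpow[OF steps, of 0 i] path_segment_relpow[OF steps, of j n] assms(2,3)
    by auto
  then have "(f 0, f n) \<in> R ^^ (i + m + (n - j))"
    using assms(4) by (auto simp: relpow_add)
  then have "n \<le> i + m + (n - j)"
    using assms(1) by (auto simp: geodesic_def)
  then show ?thesis
    using assms(3) by linarith
qed

lemma geodesic_inj:
  assumes "geodesic R f n"
  shows "inj_on f {..n}"
proof -
  have "i = j" if "i \<le> j" "j \<le> n" "f i = f j" for i j
    \<comment> \<open>A repeated vertex would be a shortcut of length 0.\<close>
    using geodesic_length_le[OF assms that(1,2), of 0] that by simp
  then show ?thesis
    by (metis atMost_iff inj_onI nat_le_linear)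
qed

section \<open>Walks that avoid a vertex\<close>

lemma rtrancl_on_path:
  assumes "\<forall>k. i \<le> k \<and> k < j \<longrightarrow> (f k, f (Suc k)) \<in> R" "f ` {i..j} \<subseteq> T" "i \<le> j"
  shows "(f i, f j) \<in> rtrancl_on T R"
  using assms(3,1,2)
proof (induction j rule: dec_induct)
  case (step k)
  then have "(f i, f k) \<in> rtrancl_on T R" "(f k, f (Suc k)) \<in> R" "f (Suc k) \<in> T"
    by (auto simp: image_subset_iff)
  then show ?case
    by (rule rtrancl_on_into_rtrancl_on)
qed auto

text \<open>Every walk from \<open>x\<close> to \<open>u\<close> must visit \<open>c\<close>, so it
  can be cut there into a walk to \<open>c\<close> and a walk from \<open>c\<close>. Deleting
  \<open>c\<close> is modelled by dropping all pairs that contain it. The cut is made for walks of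
  any length and then applied to a shortest one.\<close>

lemma rel_dist_through_separator:
  assumes "(x, u) \<notin> {(a, b). (a, b) \<in> R \<and> a \<noteq> c \<and> b \<noteq> c}\<^sup>*" (is "_ \<notin> ?R\<^sup>*")
    and "(x, u) \<in> R\<^sup>*"
  shows "rel_dist R x c + rel_dist R c u \<le> rel_dist R x u"
proof -
  have "rel_dist R x c + rel_dist R c u \<le> n" if "(x, u) \<in> R ^^ n" "(x, u) \<notin> ?R\<^sup>*" for n
  proof -
    have "\<exists>i\<le>n. (x, c) \<in> R ^^ i \<and> (c, u) \<in> R ^^ (n - i)"
      using that
    proof (induction n arbitrary: x)
      case 0
      then show ?case by simp
    next
      case (Suc n)
      then obtain y where y: "(x, y) \<in> R" "(y, u) \<in> R ^^ n"
        using relpow_Suc_D2 by metis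
      consider "x = c" | "y = c" | "x \<noteq> c" "y \<noteq> c" by blast
      then show ?case
      proof cases
        case 1
        then show ?thesis
          using Suc.prems(1) by (intro exI[of _ 0]) auto
      next
        case 2
        then show ?thesis
          using y by (intro exI[of _ 1]) auto
      next
        case 3
        then have "(x, y) \<in> ?R"
          using y(1) by simp
        then have "(y, u) \<notin> ?R\<^sup>*"
          using Suc.prems(2) by (blast intro: converse_rtrancl_into_rtrancl)
        then obtain i where "i \<le> n" "(y, c) \<in> R ^^ i" "(c, u) \<in> R ^^ (n - i)"
          using Suc.IH[OF y(2)] by blast
        then show ?thesis
          using relpow_Suc_I2[OF y(1)] by (intro exI[of _ "Suc i"]) auto
      qed
    qed
    then obtain i where "i \<le> n" "(x, c) \<in> R ^^ i" "(c, u) \<in> R ^^ (n - i)"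
      by blast
    then show ?thesis
      using rel_dist_le[of x c i R] rel_dist_le[of c u "n - i" R] by linarith
  qed
  then show ?thesis
    using relpow_rel_dist[OF assms(2)] assms(1) .
qed

text \<open>Here \<open>f\<close> closes up to a cycle through \<open>c\<close>.\<close>

lemma cycle_minus_vertex_reachable:
  assumes "sym R" and steps: "\<forall>i<n. (f i, f (Suc i)) \<in> R" and inj: "inj_on f {..n}"
    and "c \<notin> f ` {..n}" "(f 0, c) \<in> R" "(f n, c) \<in> R"
    and S: "S = insert c (f ` {..n})"
    and x: "x \<in> S - {w}" and y: "y \<in> S - {w}"
  shows "(x, y) \<in> rtrancl_on (S - {w}) R"
proof -
  have trans: "(x, y) \<in> rtrancl_on T R"
    if "(x, z) \<in> rtrancl_on T R" "(y, z) \<in> rtrancl_on T R" for x y z T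
    using rtrancl_on_sym[OF \<open>sym R\<close>] that by (metis rtrancl_on_trans symD)
  show ?thesis
  proof (cases "w = c")
    case True
    have "(f 0, z) \<in> rtrancl_on (S - {w}) R" if z: "z \<in> S - {w}" for z
    proof -
      obtain j where "j \<le> n" "z = f j"
        using z S True by auto
      then show ?thesis
        using steps S True assms(4) by (auto intro!: rtrancl_on_path)
    qed
    then show ?thesis
      using x y by (metis rtrancl_on_sym[OF \<open>sym R\<close>] rtrancl_on_trans symD)
  next
    case False
    have c: "c \<in> S - {w}"
      using False S by simp
    have "(z, c) \<in> rtrancl_on (S - {w}) R" if z: "z \<in> S - {w}" for z
    proof (cases "z = c")
      case True
      with c show ?thesis by simp
    next
      case False
      then obtain j where j: "j \<le> n" "z = f j"
        using z S by auto
      \<comment> \<open>By injectivity \<open>w\<close> occurs at most once on the path, and not at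
        \<open>j\<close>, so one of the two arcs of the cycle from \<open>z\<close> to
        \<open>c\<close> misses \<open>w\<close>.\<close>
      have nw: "(\<forall>i\<le>j. f i \<noteq> w) \<or> (\<forall>i. j \<le> i \<and> i \<le> n \<longrightarrow> f i \<noteq> w)"
      proof (rule ccontr)
        assume "\<not> ?thesis"
        then obtain i k where "i \<le> j" "f i = w" "j \<le> k" "k \<le> n" "f k = w"
          by blast
        then have "i = j"
          using inj j(1) by (metis atMost_iff inj_onD le_antisym le_trans)
        then show False
          using z j(2) \<open>f i = w\<close> by simp
      qed
      then show ?thesis
      proof
        assume *: "\<forall>i\<le>j. f i \<noteq> w"
        then have "(f 0, f j) \<in> rtrancl_on (S - {w}) R"
          using steps S j by (intro rtrancl_on_path) auto
        moreover have "(f 0, c) \<in> rtrancl_on (S - {w}) R"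
          using * c S assms(5) by (auto intro: converse_rtrancl_on_into_rtrancl_on)
        ultimately show ?thesis
          using j(2) by (metis rtrancl_on_sym[OF \<open>sym R\<close>] rtrancl_on_trans symD)
      next
        assume *: "\<forall>i. j \<le> i \<and> i \<le> n \<longrightarrow> f i \<noteq> w"
        then have "(f j, f n) \<in> rtrancl_on (S - {w}) R"
          using steps S j by (intro rtrancl_on_path) auto
        then show ?thesis
          using j(2) c assms(6) by (auto intro: rtrancl_on_into_rtrancl_on)
      qed
    qed
    then show ?thesis
      using x y trans by blast
  qed
qed

section \<open>Induced subgraphs, their connectivity, and blocks\<close>

lemma arcs_ends_induce:
  "arcs_ends (G \<restriction> S) = {(u, v). (u, v) \<in> arcs_ends G \<and> u \<in> S \<and> v \<in> S}"
  by (auto simp: arcs_ends_conv)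

lemma rtrancl_on_restrict:
  "rtrancl_on S {(u, v). (u, v) \<in> R \<and> u \<in> S \<and> v \<in> S} = rtrancl_on S R" (is "?L = ?R")
proof
  have "(a, b) \<in> ?R" if "(a, b) \<in> ?L" for a b
    using that by (rule rtrancl_on_mono[rotated 2]) auto
  then show "?L \<subseteq> ?R" by auto
  have "(a, b) \<in> ?L" if "(a, b) \<in> ?R" for a b
    using that by induct (auto intro: converse_rtrancl_on_into_rtrancl_on)
  then show "?R \<subseteq> ?L" by auto
qed

context graph
begin

lemma graph_induce:
  assumes "S \<subseteq> verts G"
  shows "graph (G \<restriction> S)"
proof -
  have ind: "induced_subgraph (G \<restriction> S) G"
    using assms by auto
  interpret H: digraph "G \<restriction> S"
    using ind by (rule digraphI_induced)
  show ?thesis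
    using induced_graph_imp_symmetric[OF sym_arcs ind] by (rule H.graphI)
qed

lemma sym_arcs_ends: "sym (arcs_ends G)"
  using sym_arcs by (simp add: symmetric_def)

text \<open>Weak connectedness refers to the symmetric closure of the adjacency relation, which is
  that relation itself in a symmetric digraph.\<close>

lemma connected_induce_iff:
  assumes "S \<subseteq> verts G"
  shows "connected (G \<restriction> S) \<longleftrightarrow>
    S \<noteq> {} \<and> (\<forall>u\<in>S. \<forall>v\<in>S. (u, v) \<in> rtrancl_on S (arcs_ends G))"
proof -
  interpret H: graph "G \<restriction> S"
    using assms by (rule graph_induce)
  have "(arcs_ends (G \<restriction> S))\<^sup>s = arcs_ends (G \<restriction> S)"
    using H.sym_arcs_ends by (auto simp: symcl_def dest: symD)
  then show ?thesis
    by (simp add: connected_conv arcs_ends_induce rtrancl_on_restrict)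
qed

text \<open>Sizes of subgraphs are bounded by that of \<open>G\<close>, so some two-connected
  subgraph containing \<open>H\<close> has the largest size; no proper extension of it can be
  two-connected.\<close>

lemma two_connected_subgraph_in_block:
  assumes "subgraph H G" "two_connected H"
  obtains B where "is_block G B" "subgraph H B"
proof -
  define P where "P B \<longleftrightarrow> subgraph B G \<and> two_connected B \<and> subgraph H B" for B
  \<comment> \<open>Arcs are counted too, because a proper extension may add arcs without adding
    vertices.\<close>
  define sz where "sz B = card (verts B) + card (arcs B)" for B :: "('a, 'b) pre_digraph"
  have "P H"
    using assms by (auto simp: P_def intro: wf_digraph.subgraph_refl)
  moreover have "\<forall>B. P B \<longrightarrow> sz B < Suc (sz G)"
    unfolding P_def sz_def by (auto simp: subgraph_def less_Suc_eq_le intro!: add_mono card_mono)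
  ultimately have "\<exists>B. P B \<and> (\<forall>B'. P B' \<longrightarrow> sz B' \<le> sz B)"
    by (rule ex_has_greatest_nat)
  then obtain B where B: "P B" "\<And>B'. P B' \<Longrightarrow> sz B' \<le> sz B"
    by blast
  have "B' = B" if "subgraph B B'" "subgraph B' G" "two_connected B'" for B'
  proof -
    have "P B'"
      using that B(1) by (auto simp: P_def intro: subgraph_trans)
    then have "sz B' \<le> sz B" by (rule B(2))
    moreover have sub: "verts B \<subseteq> verts B'" "arcs B \<subseteq> arcs B'" "compatible B' B"
      using that(1) by auto
    moreover have fin: "finite (verts B')" "finite (arcs B')"
      using that(2) finite_subset[OF _ finite_verts] finite_subset[OF _ finite_arcs]
      by (simp_all add: subgraph_def)
    ultimately have "card (verts B') \<le> card (verts B)" "card (arcs B') \<le> card (arcs B)"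
      using card_mono[OF fin(1) sub(1)] card_mono[OF fin(2) sub(2)] by (auto simp: sz_def)
    then have "verts B = verts B'" "arcs B = arcs B'"
      using sub fin by (simp_all add: card_seteq)
    \<comment> \<open>Compatibility supplies the remaining record fields, the tail and head
      functions.\<close>
    with sub(3) show ?thesis
      by (auto simp: compatible_def)
  qed
  then have "is_block G B"
    using B(1) unfolding is_block_def max_subgraph_def P_def by blast
  with B(1) that show ?thesis
    by (auto simp: P_def)
qed

text \<open>A shortest path from \<open>p\<close> to \<open>q\<close> that avoids \<open>c\<close>
  closes up through \<open>c\<close> to a cycle. The subgraph induced on its vertices is
  two-connected, hence lies in a block, which is a clique containing \<open>p\<close> and
  \<open>q\<close>.\<close>

lemma block_graph_neighbours_adjacent:
  assumes "block_graph G" "(p, c) \<in> arcs_ends G" "(c, q) \<in> arcs_ends G" "p \<noteq> q"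
    and "(p, q) \<in> {(a, b). (a, b) \<in> arcs_ends G \<and> a \<noteq> c \<and> b \<noteq> c}\<^sup>*"
  shows "(p, q) \<in> arcs_ends G"
proof -
  let ?R = "{(a, b). (a, b) \<in> arcs_ends G \<and> a \<noteq> c \<and> b \<noteq> c}"
  define n where "n = rel_dist ?R p q"
  obtain f where f: "geodesic ?R f n" "f 0 = p" "f n = q"
    unfolding n_def using assms(5) by (rule geodesic_exists)
  have n: "n > 0"
    using f(2,3) assms(4) by (cases n) auto
  have steps: "\<forall>i<n. (f i, f (Suc i)) \<in> arcs_ends G"
    using geodesic_step[OF f(1)] by auto
  have verts: "f i \<in> verts G \<and> f i \<noteq> c" if "i \<le> n" for i
  proof (cases i)
    case 0
    then show ?thesis
      using geodesic_step[OF f(1), of 0] n adj_in_verts(1) by auto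
  next
    case (Suc k)
    then show ?thesis
      using geodesic_step[OF f(1), of k] that adj_in_verts(2) by auto
  qed
  have inj: "inj_on f {..n}"
    using f(1) by (rule geodesic_inj)
  define S where "S = insert c (f ` {..n})"
  have c: "c \<notin> f ` {..n}" "c \<in> verts G"
    using verts assms(2) by auto
  have ends: "(f 0, c) \<in> arcs_ends G" "(f n, c) \<in> arcs_ends G"
    using assms(2,3) f sym_arcs_ends by (auto dest: symD)
  have S: "S \<subseteq> verts G"
    using verts c by (auto simp: S_def)
  have reach: "(x, y) \<in> rtrancl_on (S - {w}) (arcs_ends G)"
    if "x \<in> S - {w}" "y \<in> S - {w}" for x y w
    using cycle_minus_vertex_reachable[OF sym_arcs_ends steps inj c(1) ends S_def that] .
  have "card (f ` {..n}) = Suc n"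
    using inj by (simp add: card_image)
  \<comment> \<open>Since \<open>n > 0\<close>, these are at least three vertices, as
    \<open>two_connected\<close> requires.\<close>
  then have card: "card S = Suc (Suc n)"
    using c(1) by (simp add: S_def)
  have fin: "finite S"
    by (simp add: S_def)
  have "connected (G \<restriction> (S - {w}))" for w
  proof -
    have "card (S - {w}) \<ge> Suc n"
      using card fin by (simp add: card_Diff_singleton_if)
    then have "S - {w} \<noteq> {}"
      by (metis card.empty not_less_eq_eq zero_le)
    then show ?thesis
      using S reach by (subst connected_induce_iff) auto
  qed
  moreover have "connected (G \<restriction> S)"
  proof -
    have "(x, y) \<in> rtrancl_on S (arcs_ends G)" if xy: "x \<in> S" "y \<in> S" for x y
    proof -
      \<comment> \<open>A third vertex \<open>w\<close> exists, and \<open>x\<close> and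
        \<open>y\<close> are joined even without it; so connectedness of the whole follows from the
        case of a deleted vertex.\<close>
      have "card {x, y} < card S"
        using card n by (simp add: card_insert_if)
      then obtain w where "w \<in> S" "w \<notin> {x, y}"
        using card_mono[of "{x, y}" S] by (metis finite.intros leD subsetI)
      with xy have "(x, y) \<in> rtrancl_on (S - {w}) (arcs_ends G)"
        by (intro reach) auto
      then show ?thesis
        by (rule rtrancl_on_mono[rotated 2]) auto
    qed
    then show ?thesis
      using S by (subst connected_induce_iff) (auto simp: S_def)
  qed
  moreover have "(G \<restriction> S) \<restriction> (S - {w}) = G \<restriction> (S - {w})" for w
    by (auto simp: induce_subgraph_def)
  ultimately have "two_connected (G \<restriction> S)"
    using graph_induce[OF S] card n by (simp add: two_connected_def)
  moreover have "subgraph (G \<restriction> S) G"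
    using S by (intro induced_imp_subgraph) auto
  ultimately obtain B where B: "is_block G B" "subgraph (G \<restriction> S) B"
    using two_connected_subgraph_in_block by blast
  then have "is_clique B"
    using assms(1) by (auto simp: block_graph_def)
  moreover have "p \<in> S" "q \<in> S"
    using f by (auto simp: S_def)
  then have "p \<in> verts B" "q \<in> verts B"
    using subgraph_imp_subverts[OF B(2)] by auto
  ultimately have "(p, q) \<in> arcs_ends B"
    using assms(4) by (auto simp: complete_digraph_def)
  moreover have "subgraph B G"
    using B(1) by (simp add: is_block_def max_subgraph_def)
  ultimately show ?thesis
    by (rule adj_mono)
qed


section \<open>Separation by inner vertices of a geodesic, and distances to its midpoint\<close>

lemma connected_imp_rtrancl:
  assumes "connected G" "u \<in> verts G" "v \<in> verts G"
  shows "(u, v) \<in> (arcs_ends G)\<^sup>*"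
  using symmetric_connected_imp_strongly_connected[OF sym_arcs assms(1)] assms(2,3)
  by (auto simp: strongly_connected_def dest: reachable_rtranclI)

text \<open>A walk between the ends avoiding \<open>f m\<close>, prolonged along the two remaining
  pieces of the path, would join \<open>f (m - 1)\<close> to \<open>f (m + 1)\<close>. These would
  then be adjacent, a shortcut of length 1 over a segment of length 2.\<close>

lemma geodesic_vertex_separates:
  assumes "block_graph G" "geodesic (arcs_ends G) f n" "0 < m" "m < n"
  shows "(f 0, f n) \<notin> {(a, b). (a, b) \<in> arcs_ends G \<and> a \<noteq> f m \<and> b \<noteq> f m}\<^sup>*" (is "_ \<notin> ?R\<^sup>*")
proof
  assume *: "(f 0, f n) \<in> ?R\<^sup>*"
  have inj: "f i = f j \<longleftrightarrow> i = j" if "i \<le> n" "j \<le> n" for i j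
    using geodesic_inj[OF assms(2)] that by (auto dest: inj_onD)
  have step: "(f i, f (Suc i)) \<in> arcs_ends G" if "i < n" for i
    using assms(2) that by (rule geodesic_step)
  have "sym ?R"
    using sym_arcs_ends by (auto simp: sym_def)
  then have sym: "sym (?R\<^sup>*)"
    by (rule sym_rtrancl)
  have stepR: "(f k, f (Suc k)) \<in> ?R" if "k < n" "k \<noteq> m" "Suc k \<noteq> m" for k
    using step[of k] inj[of k m] inj[of "Suc k" m] that assms(4) by simp
  have "(f 0, f (m - 1)) \<in> ?R\<^sup>*"
    using stepR assms(3,4)
    by (intro rtrancl_on_rtranclI[OF rtrancl_on_path[where T = UNIV]]) simp_all
  moreover have "(f (m + 1), f n) \<in> ?R\<^sup>*"
    using stepR assms(3,4)
    by (intro rtrancl_on_rtranclI[OF rtrancl_on_path[where T = UNIV]]) simp_all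
  ultimately have reach: "(f (m - 1), f (m + 1)) \<in> ?R\<^sup>*"
    using * sym by (meson rtrancl_trans symD)
  have "(f (m - 1), f (m + 1)) \<in> arcs_ends G"
    by (rule block_graph_neighbours_adjacent[OF assms(1) _ _ _ reach])
      (use assms(3,4) step[of "m - 1"] step[of m] inj[of "m - 1" "m + 1"] in auto)
  then show False
    using geodesic_length_le[OF assms(2), of "m - 1" "m + 1" 1] assms(3,4)
    by (simp add: le_diff_conv)
qed

text \<open>If \<open>f m\<close> separates \<open>x\<close> from \<open>f 0\<close>, the distance
  from \<open>x\<close> to \<open>f m\<close> is at most \<open>n - m\<close>; if it separates
  \<open>x\<close> from \<open>f n\<close>, it is at most \<open>m\<close>. With
  \<open>m = n div 2\<close> the first bound is the weaker one and accounts for the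
  \<open>+ 1\<close>.\<close>

lemma center_bound:
  assumes "connected G" "block_graph G" "geodesic (arcs_ends G) f n" "f 0 \<in> verts G" "f n \<in> verts G"
    and m: "m = n div 2" and "f m \<in> verts G" "x \<in> verts G"
    and diam: "\<And>y. y \<in> verts G \<Longrightarrow> rel_dist (arcs_ends G) x y \<le> n"
  shows "2 * rel_dist (arcs_ends G) x (f m) \<le> n + 1"
proof (cases "m = 0")
  \<comment> \<open>Here \<open>f m\<close> is an end of the path and need not separate anything,
    but \<open>n \<le> 1\<close>, so the bound \<open>n\<close> on the distance suffices.\<close>
  case True
  then show ?thesis
    using diam[of "f m"] assms(7) m by simp
next
  case False
  let ?E = "arcs_ends G"
  let ?R = "{(a, b). (a, b) \<in> ?E \<and> a \<noteq> f m \<and> b \<noteq> f m}"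
  have "sym ?R"
    using sym_arcs_ends by (auto simp: sym_def)
  then have "sym (?R\<^sup>*)"
    by (rule sym_rtrancl)
  moreover have "(f 0, f n) \<notin> ?R\<^sup>*"
    using False m by (intro geodesic_vertex_separates[OF assms(2,3)]) auto
  \<comment> \<open>If \<open>x\<close> could reach both ends without \<open>f m\<close>, the ends
    would be joined through \<open>x\<close>.\<close>
  ultimately have "(x, f 0) \<notin> ?R\<^sup>* \<or> (x, f n) \<notin> ?R\<^sup>*"
    by (meson rtrancl_trans symD)
  then show ?thesis
  proof
    assume "(x, f 0) \<notin> ?R\<^sup>*"
    then have "rel_dist ?E x (f m) + rel_dist ?E (f m) (f 0) \<le> rel_dist ?E x (f 0)"
      using assms by (intro rel_dist_through_separator connected_imp_rtrancl)
    also have "\<dots> \<le> n"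
      using diam assms(4) .
    finally have "rel_dist ?E x (f m) + rel_dist ?E (f 0) (f m) \<le> n"
      using rel_dist_commute[OF sym_arcs_ends] by metis
    moreover have "m \<le> rel_dist ?E (f 0) (f m)"
      using geodesic_length_le[OF assms(3), of 0 m] relpow_rel_dist m
        connected_imp_rtrancl[OF assms(1,4,7)] by fastforce
    ultimately show ?thesis
      using m by linarith
  next
    assume "(x, f n) \<notin> ?R\<^sup>*"
    then have "rel_dist ?E x (f m) + rel_dist ?E (f m) (f n) \<le> rel_dist ?E x (f n)"
      using assms by (intro rel_dist_through_separator connected_imp_rtrancl)
    also have "\<dots> \<le> n"
      using diam assms(5) .
    moreover have "n \<le> m + rel_dist ?E (f m) (f n)"
      using geodesic_length_le[OF assms(3), of m n] relpow_rel_dist m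
        connected_imp_rtrancl[OF assms(1,7,5)] by fastforce
    ultimately show ?thesis
      using m by linarith
  qed
qed

section \<open>Graph distance in terms of powers of the adjacency relation\<close>

lemma awalk_imp_relpow: "awalk u p v \<Longrightarrow> (u, v) \<in> arcs_ends G ^^ length p"
proof (induction p arbitrary: u)
  case Nil
  then show ?case by (simp add: awalk_Nil_iff)
next
  case (Cons e p)
  then have "(u, head G e) \<in> arcs_ends G" "(head G e, v) \<in> arcs_ends G ^^ length p"
    by (auto simp: awalk_Cons_iff arcs_ends_conv)
  then have "(u, v) \<in> arcs_ends G ^^ Suc (length p)"
    by (rule relpow_Suc_I2)
  then show ?case
    by (simp del: relpow.simps)
qed

lemma relpow_imp_awalk:
  assumes "(u, v) \<in> arcs_ends G ^^ n" "u \<in> verts G"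
  shows "\<exists>p. awalk u p v \<and> length p = n"
  using assms
proof (induction n arbitrary: u)
  case 0
  then show ?case by (simp add: awalk_Nil_iff)
next
  case (Suc n)
  then obtain w where w: "(u, w) \<in> arcs_ends G" "(w, v) \<in> arcs_ends G ^^ n"
    using relpow_Suc_D2 by metis
  then obtain e where e: "e \<in> arcs G" "tail G e = u" "head G e = w"
    by (auto simp: arcs_ends_conv)
  then obtain p where "awalk w p v" "length p = n"
    using Suc.IH[OF w(2)] by auto
  then have "awalk u (e # p) v \<and> length (e # p) = Suc n"
    using e by (simp add: awalk_Cons_iff)
  then show ?case by blast
qed

text \<open>With unit weights the cost of a walk is its length, and walks of length \<open>n\<close>
  correspond to the \<open>n\<close>-th relation power. The infimum of costs is therefore attained
  at the least such \<open>n\<close>.\<close>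

lemma graph_dist_eq_rel_dist:
  assumes "(u, v) \<in> (arcs_ends G)\<^sup>*" "u \<in> verts G"
  shows "graph_dist G u v = ereal (real (rel_dist (arcs_ends G) u v))"
proof (rule antisym)
  have cost: "awalk_cost (\<lambda>_. 1) p = real (length p)" for p :: "'b awalk"
    by (induction p) auto
  obtain p where "awalk u p v" "length p = rel_dist (arcs_ends G) u v"
    using relpow_imp_awalk[OF relpow_rel_dist] assms by metis
  then show "graph_dist G u v \<le> ereal (real (rel_dist (arcs_ends G) u v))"
    using min_cost_le_walk_cost[of u p v "\<lambda>_. 1"] by (simp add: graph_dist_def cost)
  show "ereal (real (rel_dist (arcs_ends G) u v)) \<le> graph_dist G u v"
    unfolding graph_dist_def \<mu>_def
    by (rule INF_greatest) (auto simp: cost intro: rel_dist_le awalk_imp_relpow)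
qed

end

section \<open>Cluster graphs and cluster deletion sets\<close>

lemma cluster_graph_adj_trans:
  assumes "cluster_graph G" "(a, b) \<in> arcs_ends G" "(b, c) \<in> arcs_ends G" "a \<noteq> c"
  shows "(a, c) \<in> arcs_ends G"
proof -
  obtain P where P: "partition_on (verts G) P"
    "arcs_ends G = (\<Union>C\<in>P. {(u, v). u \<in> C \<and> v \<in> C \<and> u \<noteq> v})"
    using assms(1) by (auto simp: cluster_graph_def)
  then obtain C D where "C \<in> P" "D \<in> P" "a \<in> C" "b \<in> C" "b \<in> D" "c \<in> D"
    using assms(2,3) by auto
  \<comment> \<open>Distinct parts are disjoint, but both of these contain \<open>b\<close>.\<close>
  moreover have "C = D"
    using partition_onD2[OF P(1)] calculation by (auto simp: disjoint_def)
  ultimately show ?thesis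
    using P(2) assms(4) by auto
qed

text \<open>
  A geodesic splits into triples of consecutive vertices, each inducing a path on three vertices,
  and every one of these triples contains a deleted vertex.
\<close>

lemma geodesic_length_le_cluster_deletion:
  assumes "geodesic (arcs_ends G) f n" "finite S" "\<And>i. i \<le> n \<Longrightarrow> f i \<in> verts G"
    and "cluster_graph (G \<restriction> (verts G - S))"
  shows "n \<le> 3 * card S + 1"
proof -
  have "\<exists>i. 3 * k \<le> i \<and> i \<le> 3 * k + 2 \<and> f i \<in> S" if k: "3 * k + 2 \<le> n" for k
  proof (rule ccontr)
    assume none: "\<not> ?thesis"
    define i where "i = 3 * k"
    have notin: "f i \<in> verts G - S" "f (i + 1) \<in> verts G - S" "f (i + 2) \<in> verts G - S"
      using none k assms(3) by (auto simp: i_def)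
    have "(f i, f (i + 1)) \<in> arcs_ends G" "(f (i + 1), f (i + 2)) \<in> arcs_ends G"
      using geodesic_step[OF assms(1), of i] geodesic_step[OF assms(1), of "i + 1"] k
      by (auto simp: i_def)
    moreover have "f i \<noteq> f (i + 2)"
      using inj_onD[OF geodesic_inj[OF assms(1)], of i "i + 2"] k by (auto simp: i_def)
    ultimately have "(f i, f (i + 2)) \<in> arcs_ends G"
      using cluster_graph_adj_trans[OF assms(4), of "f i" "f (i + 1)" "f (i + 2)"] notin
      by (simp add: arcs_ends_induce)
    then show False
      using geodesic_length_le[OF assms(1), of i "i + 2" 1] k by (simp add: i_def)
  qed
  then obtain h where h: "3 * k \<le> h k" "h k \<le> 3 * k + 2" "f (h k) \<in> S" if "3 * k + 2 \<le> n" for k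
    by metis
  \<comment> \<open>The condition \<open>k < (n + 1) div 3\<close> says exactly that the triple
    starting at \<open>3 * k\<close> fits on the path. Distinct triples use disjoint index ranges,
    so their deleted vertices differ.\<close>
  have "inj_on (\<lambda>k. f (h k)) {..<(n + 1) div 3}"
  proof (rule inj_onI)
    fix k l
    assume "k \<in> {..<(n + 1) div 3}" "l \<in> {..<(n + 1) div 3}" and eq: "f (h k) = f (h l)"
    then have kl: "3 * k + 2 \<le> n" "3 * l + 2 \<le> n"
      by auto
    then have "h k = h l"
      using h[of k] h[of l] eq
      by (intro inj_onD[OF geodesic_inj[OF assms(1)] eq]) auto
    then show "k = l"
      using h(1,2)[OF kl(1)] h(1,2)[OF kl(2)] by linarith
  qed
  moreover have "(\<lambda>k. f (h k)) ` {..<(n + 1) div 3} \<subseteq> S"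
    using h(3) by auto
  ultimately have "(n + 1) div 3 \<le> card S"
    using card_inj_on_le[OF _ _ assms(2)] by force
  \<comment> \<open>Rounding: \<open>(n + 1) div 3 \<le> card S\<close> means
    \<open>n + 1 \<le> 3 * card S + 2\<close>.\<close>
  then show ?thesis
    by linarith
qed

text \<open>The minimum is attained because the set of candidate sizes is finite and nonempty:
  deleting all vertices leaves the empty graph, a cluster graph with the empty partition.\<close>

lemma (in graph) dc_witness:
  obtains S where "S \<subseteq> verts G" "cluster_graph (G \<restriction> (verts G - S))" "card S = dc G"
proof -
  let ?D = "{card S |S. S \<subseteq> verts G \<and> cluster_graph (G \<restriction> (verts G - S))}"
  have "finite ?D"
    by (rule finite_subset[of _ "card ` Pow (verts G)"]) auto
  moreover have "cluster_graph (G \<restriction> {})"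
    using graph_induce[of "{}"]
    by (auto simp: cluster_graph_def arcs_ends_induce partition_on_def intro!: exI[of _ "{}"])
  then have "card (verts G) \<in> ?D"
    by auto
  ultimately have "dc G \<in> ?D"
    unfolding dc_def by (intro Min_in) auto
  then show ?thesis
    using that by auto
qed

section \<open>Eccentricity of the midpoint of a diametral path\<close>

theorem theorem9:
  fixes G :: "('a,'b) pre_digraph"
  assumes "graph G" and "connected_graph G" and "block_graph G"
  shows "rad G \<le> ereal (3 / 2 * real (dc G) + 1)"
proof -
  interpret graph G by fact
  let ?V = "verts G" and ?d = "rel_dist (arcs_ends G)"
  have ne: "?V \<noteq> {}"
    using assms(2) by (auto simp: connected_conv)
  have reach: "(u, v) \<in> (arcs_ends G)\<^sup>*" if "u \<in> ?V" "v \<in> ?V" for u v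
    using assms(2) that by (rule connected_imp_rtrancl)
  \<comment> \<open>The largest value in \<open>?D\<close> is the diameter; a pair \<open>u\<close>,
    \<open>v\<close> attaining it provides the ends of the path.\<close>
  let ?D = "case_prod ?d ` (?V \<times> ?V)"
  have "Max ?D \<in> ?D"
    using ne by (intro Max_in) auto
  then obtain u v where uv: "u \<in> ?V" "v \<in> ?V" "Max ?D = ?d u v"
    by auto
  have diam: "?d x y \<le> ?d u v" if "x \<in> ?V" "y \<in> ?V" for x y
    unfolding uv(3)[symmetric] using that by (intro Max_ge) auto
  define n where "n = ?d u v"
  obtain f where f: "geodesic (arcs_ends G) f n" "f 0 = u" "f n = v"
    unfolding n_def using reach[OF uv(1,2)] by (rule geodesic_exists)
  have fV: "f i \<in> ?V" if "i \<le> n" for i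
  proof (cases i)
    case 0
    then show ?thesis
      using f(2) uv(1) by simp
  next
    case (Suc k)
    then show ?thesis
      using geodesic_step[OF f(1), of k] that adj_in_verts(2) by auto
  qed
  obtain S where S: "S \<subseteq> ?V" "cluster_graph (G \<restriction> (?V - S))" "card S = dc G"
    by (rule dc_witness)
  have n: "n \<le> 3 * dc G + 1"
    using geodesic_length_le_cluster_deletion[OF f(1) finite_subset[OF S(1) finite_verts] fV S(2)] S(3)
    by simp
  define c where "c = f (n div 2)"
  have c: "c \<in> ?V"
    by (simp add: c_def fV)
  have ecc: "graph_dist G c x \<le> ereal (3 / 2 * real (dc G) + 1)" if x: "x \<in> ?V" for x
  proof -
    have "2 * ?d x c \<le> n + 1"
      unfolding c_def
      by (rule center_bound[OF assms(2,3) f(1) _ _ refl]) (use x fV diam n_def in auto)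
    \<comment> \<open>This combines \<open>n + 1\<close> from the midpoint with
      \<open>n \<le> 3 * dc G + 1\<close> from the triples; halving gives the claimed
      constant.\<close>
    then have "2 * ?d c x \<le> 3 * dc G + 2"
      using n rel_dist_commute[OF sym_arcs_ends, of c x] by simp
    then show ?thesis
      using graph_dist_eq_rel_dist[OF reach[OF c x] c] by simp
  qed
  have "rad G \<le> (MAX v\<in>?V. graph_dist G c v)"
    unfolding rad_def using c by (intro Min_le) auto
  also have "\<dots> \<le> ereal (3 / 2 * real (dc G) + 1)"
    using ecc ne by (intro Max.boundedI) auto
  finally show ?thesis .
qed

end
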